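(* Let $a\ge3$ be an integer, $p\in(0,1)$, $q=1-p$, and let $z_1,\dots,z_m\in\{1,\dots,a-1\}$ be distinct reset sites forming a set stable under $z\mapsto a-z$ and containing at least one $z$ with $z\neq a-z$. For the biased random walk of the context, the coupling functional $$C(\pi,\gamma)=\frac{\sum_{i=1}^m\pi_i u(z_i;\gamma)}{\sum_{i=1}^m\pi_i s(z_i;\gamma)},\qquad \pi\in\Delta_{m-1},\ \gamma\in(0,1),$$ satisfies conditions (S1)--(S4) of the context, with $N=a-1$, $$f_\nu(\gamma)=\frac{1-\gamma}{1-\lambda_\nu(1-\gamma)},\qquad \lambda_\nu=2\sqrt{pq}\cos\frac{\pi\nu}{a},$$ $$A_\nu(z)=\frac{2\sqrt{pq}}{a}\Bigl(\frac qp\Bigr)^{z/2}\sin\frac{\pi\nu z}{a}\sin\frac{\pi\nu}{a},\qquad B_\nu(z)=\frac{2\sqrt{pq}}{a}\Bigl(\frac pq\Bigr)^{(a-z)/2}\sin\frac{\pi\nu(a-z)}{a}\sin\frac{\pi\nu}{a}\qquad(1\le\nu\le a-1),$$ involution $\sigma(z)=a-z$, weights $\kappa(z)=(p/q)^{a-z}$ and compatibility constant $K=(p/q)^a$. (In the trigonometric and spectral formulas $\pi$ denotes the number $3.14\ldots$.)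
   Context: Random walk: $(X_n)_{n\ge0}$ is the random walk (without resetting) on $\{0,1,\dots,a\}$ with absorbing boundaries $0$ and $a$, moving from $x\in\{1,\dots,a-1\}$ to $x+1$ with probability $p$ and to $x-1$ with probability $q$. With $\tau_0,\tau_a$ the hitting times of $0,a$ and $\tau=\min\{\tau_0,\tau_a\}$, for $z\in\{1,\dots,a-1\}$ and $\gamma\in(0,1)$ put $u(z;\gamma)=\mathbb{E}_z[(1-\gamma)^{\tau_0}\mathbf{1}_{\{\tau_0<\tau_a\}}]$ and $s(z;\gamma)=\mathbb{E}_z[(1-\gamma)^{\tau}]$. Simplex: $\Delta_{m-1}=\{\pi\in\mathbb{R}^m:\pi_i\ge0,\sum_i\pi_i=1\}$, with relative interior $\Delta_{m-1}^\circ$ (all $\pi_i>0$). Conditions on $C:\Delta_{m-1}\times(0,1)\to\mathbb{R}$: (S1) For each fixed $\gamma\in(0,1)$ the map $\pi\mapsto C(\pi,\gamma)$ is of class $\mathcal{C}^1$ on $\Delta_{m-1}^\circ$ and extends continuously to the boundary. (S2) $C(\pi,\gamma)=\dfrac{\sum_{i}\pi_i u(z_i;\gamma)}{\sum_{i}\pi_i s(z_i;\gamma)}$ with denominator strictly positive for all $\pi\in\Delta_{m-1}$, $\gamma\in(0,1)$; $u(z;\gamma)=\sum_{\nu=1}^N f_\nu(\gamma)A_\nu(z)$ and $s(z;\gamma)=\sum_{\nu=1}^N f_\nu(\gamma)(A_\nu(z)+B_\nu(z))$; the functions $f_1,\dots,f_N$ are linearly independent on $(0,1)$; and the $m$ vectors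 $(A_\nu(z_i))_{\nu=1}^N$, $i=1,\dots,m$, are linearly independent in $\mathbb{R}^N$. (S3) $\sigma$ is an involution of the set of reset sites, $\kappa(z)>0$ is independent of $\nu$, and $B_\nu(z)=\kappa(z)A_\nu(\sigma(z))$ for all $\nu$ and all reset sites $z$; at least one site has $\sigma(z)\neq z$. (S4) $\kappa(z)\kappa(\sigma(z))=K$ for all reset sites $z$, with $K>0$ a constant. *)

theory Defs
  imports "HOL-Probability.Probability"
begin

text \<open>The walk on \<open>{0..a}\<close> started at \<open>z\<close> is driven by i.i.d. steps: \<open>True\<close> (probability \<open>p\<close>) moves
  up, \<open>False\<close> (probability \<open>1 - p\<close>) moves down. Both \<open>0\<close> and \<open>a\<close> are absorbing.\<close>

definition step_space :: "real \<Rightarrow> bool stream measure" where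
  "step_space p = stream_space (measure_pmf (bernoulli_pmf p))"

primrec walk :: "nat \<Rightarrow> nat \<Rightarrow> bool stream \<Rightarrow> nat \<Rightarrow> nat" where
  "walk a z \<omega> 0 = z"
| "walk a z \<omega> (Suc n) =
     (if walk a z \<omega> n = 0 \<or> walk a z \<omega> n = a then walk a z \<omega> n
      else if \<omega> !! n then walk a z \<omega> n + 1 else walk a z \<omega> n - 1)"

text \<open>The infimum of the empty set is \<open>\<infinity>\<close>: the time of a visit that never happens.\<close>

definition hitting_time :: "nat \<Rightarrow> (nat \<Rightarrow> nat) \<Rightarrow> enat" where
  "hitting_time b x = Inf {enat n | n. x n = b}"

text \<open>\<open>r\<^sup>t\<close> for \<open>0 < r < 1\<close>, with \<open>r\<^sup>\<infinity> = 0\<close>.\<close>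

definition discount :: "real \<Rightarrow> enat \<Rightarrow> real" where
  "discount r t = (case t of enat n \<Rightarrow> r ^ n | \<infinity> \<Rightarrow> 0)"

definition walk_u :: "nat \<Rightarrow> real \<Rightarrow> nat \<Rightarrow> real \<Rightarrow> real" where
  "walk_u a p z \<gamma> =
     (\<integral>\<omega>. discount (1 - \<gamma>) (hitting_time 0 (walk a z \<omega>))
          * of_bool (hitting_time 0 (walk a z \<omega>) < hitting_time a (walk a z \<omega>)) \<partial>step_space p)"

definition walk_s :: "nat \<Rightarrow> real \<Rightarrow> nat \<Rightarrow> real \<Rightarrow> real" where
  "walk_s a p z \<gamma> =
     (\<integral>\<omega>. discount (1 - \<gamma>) (min (hitting_time 0 (walk a z \<omega>)) (hitting_time a (walk a z \<omega>)))
        \<partial>step_space p)"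

definition prob_simplex :: "(real ^ 'm) set" where
  "prob_simplex = {w. (\<forall>i. 0 \<le> w $ i) \<and> (\<Sum>i\<in>UNIV. w $ i) = 1}"

definition prob_simplex_interior :: "(real ^ 'm) set" where
  "prob_simplex_interior = {w \<in> prob_simplex. \<forall>i. 0 < w $ i}"

definition coupling ::
    "(nat \<Rightarrow> real \<Rightarrow> real) \<Rightarrow> (nat \<Rightarrow> real \<Rightarrow> real) \<Rightarrow> ('m \<Rightarrow> nat) \<Rightarrow> real ^ 'm \<Rightarrow> real \<Rightarrow> real" where
  "coupling u s z w \<gamma> =
     (\<Sum>i\<in>UNIV. w $ i * u (z i) \<gamma>) / (\<Sum>i\<in>UNIV. w $ i * s (z i) \<gamma>)"

text \<open>For a relatively open subset \<open>S\<close> of an affine subspace the derivative within \<open>S\<close> is determined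
  only along the direction of that subspace; being \<open>C\<^sup>1\<close> on \<open>S\<close> means that it can be chosen
  continuously.\<close>

definition C1_on :: "'a::real_normed_vector set \<Rightarrow> ('a \<Rightarrow> real) \<Rightarrow> bool" where
  "C1_on S g \<longleftrightarrow>
     (\<exists>D :: 'a \<Rightarrow> 'a \<Rightarrow>\<^sub>L real. continuous_on S D
        \<and> (\<forall>x\<in>S. (g has_derivative blinfun_apply (D x)) (at x within S)))"

text \<open>The functional is given on the whole closed simplex, so its continuous extension to the
  boundary is the functional itself.\<close>

definition cond_S1 :: "(real ^ 'm \<Rightarrow> real \<Rightarrow> real) \<Rightarrow> bool" where
  "cond_S1 C \<longleftrightarrow>
     (\<forall>\<gamma>\<in>{0<..<1}. C1_on prob_simplex_interior (\<lambda>w. C w \<gamma>)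
                     \<and> continuous_on prob_simplex (\<lambda>w. C w \<gamma>))"

text \<open>Linear independence is that of indexed families, with indices \<open>\<nu> \<in> {1..N}\<close> for the functions
  and \<open>i :: 'm\<close> for the vectors \<open>(A \<nu> (z i))\<^sub>\<nu>\<close> of \<open>\<real>\<^sup>N\<close>. The spectral expansions are required on all
  of \<open>{1..a-1}\<close>, the domain of \<open>u\<close> and \<open>s\<close>.\<close>

definition cond_S2 ::
    "nat \<Rightarrow> (nat \<Rightarrow> real \<Rightarrow> real) \<Rightarrow> (nat \<Rightarrow> real \<Rightarrow> real) \<Rightarrow> ('m \<Rightarrow> nat)
      \<Rightarrow> (real ^ 'm \<Rightarrow> real \<Rightarrow> real)
      \<Rightarrow> nat \<Rightarrow> (nat \<Rightarrow> real \<Rightarrow> real) \<Rightarrow> (nat \<Rightarrow> nat \<Rightarrow> real) \<Rightarrow> (nat \<Rightarrow> nat \<Rightarrow> real) \<Rightarrow> bool" where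
  "cond_S2 a u s z C N f A B \<longleftrightarrow>
     (\<forall>w\<in>prob_simplex. \<forall>\<gamma>\<in>{0<..<1}.
        (\<Sum>i\<in>UNIV. w $ i * s (z i) \<gamma>) > 0
        \<and> C w \<gamma> = (\<Sum>i\<in>UNIV. w $ i * u (z i) \<gamma>) / (\<Sum>i\<in>UNIV. w $ i * s (z i) \<gamma>))
     \<and> (\<forall>x\<in>{1..a-1}. \<forall>\<gamma>\<in>{0<..<1}.
          u x \<gamma> = (\<Sum>\<nu>=1..N. f \<nu> \<gamma> * A \<nu> x)
          \<and> s x \<gamma> = (\<Sum>\<nu>=1..N. f \<nu> \<gamma> * (A \<nu> x + B \<nu> x)))
     \<and> (\<forall>c :: nat \<Rightarrow> real.
          (\<forall>\<gamma>\<in>{0<..<1}. (\<Sum>\<nu>=1..N. c \<nu> * f \<nu> \<gamma>) = 0) \<longrightarrow> (\<forall>\<nu>\<in>{1..N}. c \<nu> = 0))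
     \<and> (\<forall>c :: 'm \<Rightarrow> real.
          (\<forall>\<nu>\<in>{1..N}. (\<Sum>i\<in>UNIV. c i * A \<nu> (z i)) = 0) \<longrightarrow> (\<forall>i. c i = 0))"

definition cond_S3 ::
    "nat set \<Rightarrow> nat \<Rightarrow> (nat \<Rightarrow> nat \<Rightarrow> real) \<Rightarrow> (nat \<Rightarrow> nat \<Rightarrow> real)
      \<Rightarrow> (nat \<Rightarrow> nat) \<Rightarrow> (nat \<Rightarrow> real) \<Rightarrow> bool" where
  "cond_S3 Z N A B \<sigma> \<kappa> \<longleftrightarrow>
     (\<forall>x\<in>Z. \<sigma> x \<in> Z \<and> \<sigma> (\<sigma> x) = x)
     \<and> (\<forall>x\<in>Z. \<kappa> x > 0)
     \<and> (\<forall>\<nu>\<in>{1..N}. \<forall>x\<in>Z. B \<nu> x = \<kappa> x * A \<nu> (\<sigma> x))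
     \<and> (\<exists>x\<in>Z. \<sigma> x \<noteq> x)"

definition cond_S4 :: "nat set \<Rightarrow> (nat \<Rightarrow> nat) \<Rightarrow> (nat \<Rightarrow> real) \<Rightarrow> real \<Rightarrow> bool" where
  "cond_S4 Z \<sigma> \<kappa> K \<longleftrightarrow> K > 0 \<and> (\<forall>x\<in>Z. \<kappa> x * \<kappa> (\<sigma> x) = K)"

definition walk_lambda :: "nat \<Rightarrow> real \<Rightarrow> real \<Rightarrow> nat \<Rightarrow> real" where
  "walk_lambda a p q \<nu> = 2 * sqrt (p * q) * cos (pi * real \<nu> / real a)"

definition walk_f :: "nat \<Rightarrow> real \<Rightarrow> real \<Rightarrow> nat \<Rightarrow> real \<Rightarrow> real" where
  "walk_f a p q \<nu> \<gamma> = (1 - \<gamma>) / (1 - walk_lambda a p q \<nu> * (1 - \<gamma>))"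

definition walk_A :: "nat \<Rightarrow> real \<Rightarrow> real \<Rightarrow> nat \<Rightarrow> nat \<Rightarrow> real" where
  "walk_A a p q \<nu> x =
     2 * sqrt (p * q) / real a * (q / p) powr (real x / 2)
       * sin (pi * real \<nu> * real x / real a) * sin (pi * real \<nu> / real a)"

definition walk_B :: "nat \<Rightarrow> real \<Rightarrow> real \<Rightarrow> nat \<Rightarrow> nat \<Rightarrow> real" where
  "walk_B a p q \<nu> x =
     2 * sqrt (p * q) / real a * (p / q) powr ((real a - real x) / 2)
       * sin (pi * real \<nu> * (real a - real x) / real a) * sin (pi * real \<nu> / real a)"

end

(* Conditioning on the first step shows that u and s solve a discounted Dirichlet problem on {0..a},
   whose solution is unique by the maximum principle. The vectors A_nu are eigenvectors, with
   eigenvalue lambda_nu, of the one-step operator killed at 0 and a, and by orthogonality of the sines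
   they sum to the one-step exit probability at 0; so the resolvent expansion with coefficients f_nu
   solves the same problem. The B_nu are the A_nu after reflection x -> a - x and exchange of p and q.
   In the variable 1/(1 - gamma) the f_nu are simple fractions with distinct poles lambda_nu,
   hence linearly independent; the vectors A(z_i) are independent by orthogonality again. *)

theory Submission imports Defs begin

section \<open>First-step analysis\<close>

lemma hitting_time_eq:
  "hitting_time b x = (if \<exists>n. x n = b then enat (LEAST n. x n = b) else \<infinity>)"
proof (cases "\<exists>n. x n = b")
  case True
  then have "x (LEAST n. x n = b) = b"
    by (rule LeastI_ex)
  then have "Inf {enat n | n. x n = b} = enat (LEAST n. x n = b)"
    by (intro cInf_eq_minimum) (auto intro: Least_le)
  with True show ?thesis
    by (simp add: hitting_time_def)
qed (simp add: hitting_time_def top_enat_def)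

lemma hitting_time_start: "x 0 = b \<Longrightarrow> hitting_time b x = 0"
  unfolding hitting_time_eq by (auto simp: zero_enat_def Least_eq_0)

lemma hitting_time_never: "(\<And>n. x n \<noteq> b) \<Longrightarrow> hitting_time b x = \<infinity>"
  unfolding hitting_time_eq by auto

text \<open>A visit can only happen at a positive time, so dropping time 0 makes the first one
  earlier by exactly one. Without a visit both sides are \<open>\<infinity>\<close>.\<close>

lemma hitting_time_shift:
  assumes "x 0 \<noteq> b"
  shows "hitting_time b x = eSuc (hitting_time b (\<lambda>n. x (Suc n)))"
proof (cases "\<exists>n. x n = b")
  case True
  then obtain n where n: "x n = b" by auto
  then obtain m where "n = Suc m"
    using assms by (cases n) auto
  then show ?thesis
    using n assms Least_Suc[of "\<lambda>n. x n = b" n] by (auto simp: hitting_time_eq eSuc_enat)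
qed (auto simp: hitting_time_eq)

lemma discount_zero [simp]: "discount r 0 = 1"
  by (simp add: discount_def zero_enat_def)

lemma discount_infinity [simp]: "discount r \<infinity> = 0"
  by (simp add: discount_def)

lemma discount_eSuc: "discount r (eSuc t) = r * discount r t"
  by (cases t) (simp_all add: discount_def eSuc_enat)

lemma discount_nonneg: "0 \<le> r \<Longrightarrow> 0 \<le> discount r t"
  by (cases t) (simp_all add: discount_def)

lemma discount_le_1: "0 \<le> r \<Longrightarrow> r \<le> 1 \<Longrightarrow> discount r t \<le> 1"
  by (cases t) (simp_all add: discount_def power_le_one)

lemma walk_absorbed: "x = 0 \<or> x = a \<Longrightarrow> walk a x \<omega> n = x"
  by (induction n) auto

text \<open>The letter \<open>b\<close> is consumed at the interior site \<open>x\<close>; from then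
  on both walks stand at the same site and read the same letters of \<open>\<omega>\<close>.\<close>

lemma walk_SCons:
  assumes "0 < x" "x < a"
  shows "walk a x (b ## \<omega>) (Suc n) = walk a (if b then x + 1 else x - 1) \<omega> n"
  using assms by (induction n) auto

section \<open>Measurability of the exit quantities\<close>

lemma measurable_walk [measurable]:
  "(\<lambda>\<omega>. walk a x \<omega> n) \<in> measurable (step_space p) (count_space UNIV)"
proof (induction n)
  case (Suc n)
  note Suc [measurable]
  have [measurable]: "(\<lambda>\<omega>. \<omega> !! n) \<in> measurable (step_space p) (count_space UNIV)"
    unfolding step_space_def by measurable
  show ?case
    by simp measurable
qed simp

lemma measurable_hitting_time [measurable]:
  "(\<lambda>\<omega>. hitting_time b (walk a x \<omega>)) \<in> measurable (step_space p) (count_space UNIV)"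
  unfolding hitting_time_eq by measurable

lemma measurable_discount [measurable]: "discount r \<in> borel_measurable (count_space UNIV)"
  by simp

text \<open>Since \<open>enat\<close> is countable, it suffices to fix the value of one hitting time
  and to study the other, which is measurable into a discrete space.\<close>

lemma measurable_hits_0_first [measurable]:
  "Measurable.pred (step_space p)
    (\<lambda>\<omega>. hitting_time 0 (walk a x \<omega>) < hitting_time a (walk a x \<omega>))"
  by (rule measurable_compose_countable[OF _ measurable_hitting_time[of 0]])
    (rule measurable_compose[OF measurable_hitting_time[of a]], simp)

lemma measurable_exit_time [measurable]:
  "(\<lambda>\<omega>. min (hitting_time 0 (walk a x \<omega>)) (hitting_time a (walk a x \<omega>)))
    \<in> measurable (step_space p) (count_space UNIV)"
  by (rule measurable_compose_countable[OF _ measurable_hitting_time[of 0]])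
    (rule measurable_compose[OF measurable_hitting_time[of a]], simp)

section \<open>Conditioning on the first step\<close>

lemma prob_space_step_space: "prob_space (step_space p)"
  unfolding step_space_def by (intro prob_space.prob_space_stream_space measure_pmf.prob_space_axioms)

text \<open>A random stream is an independent first letter followed by a stream of the same law. The
  splitting takes place in the nonnegative integral; the bounds 0 and 1 make every integrand
  integrable, which allows passing to the real integral and back.\<close>

lemma integral_step_space:
  fixes F :: "bool stream \<Rightarrow> real"
  assumes p: "0 < p" "p < 1"
    and F [measurable]: "F \<in> borel_measurable (step_space p)"
    and F_bounds: "\<And>\<omega>. 0 \<le> F \<omega>" "\<And>\<omega>. F \<omega> \<le> 1"
  shows "(\<integral>\<omega>. F \<omega> \<partial>step_space p)
    = p * (\<integral>\<omega>. F (True ## \<omega>) \<partial>step_space p) + (1 - p) * (\<integral>\<omega>. F (False ## \<omega>) \<partial>step_space p)"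
proof -
  interpret S: prob_space "step_space p"
    by (rule prob_space_step_space)
  have [measurable]: "(\<lambda>\<omega>. F (b ## \<omega>)) \<in> borel_measurable (step_space p)" for b
    using F unfolding step_space_def by measurable
  have eq: "ennreal (\<integral>\<omega>. G \<omega> \<partial>step_space p) = (\<integral>\<^sup>+\<omega>. G \<omega> \<partial>step_space p)"
    if [measurable]: "G \<in> borel_measurable (step_space p)"
      and "\<And>\<omega>. 0 \<le> G \<omega>" "\<And>\<omega>. G \<omega> \<le> 1" for G :: "bool stream \<Rightarrow> real"
    using that by (intro nn_integral_eq_integral[symmetric] S.integrable_const_bound[of _ 1]) auto
  have nonneg: "0 \<le> (\<integral>\<omega>. F (b ## \<omega>) \<partial>step_space p)" for b
    by (simp add: F_bounds)
  have "ennreal (\<integral>\<omega>. F \<omega> \<partial>step_space p) = (\<integral>\<^sup>+\<omega>. F \<omega> \<partial>step_space p)"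
    by (rule eq[OF F F_bounds])
  also have "\<dots> = (\<integral>\<^sup>+b. (\<integral>\<^sup>+\<omega>. F (b ## \<omega>) \<partial>step_space p) \<partial>measure_pmf (bernoulli_pmf p))"
    using F unfolding step_space_def
    by (intro prob_space.nn_integral_stream_space[OF measure_pmf.prob_space_axioms]) simp
  also have "\<dots> = (\<integral>\<^sup>+b. ennreal (\<integral>\<omega>. F (b ## \<omega>) \<partial>step_space p) \<partial>measure_pmf (bernoulli_pmf p))"
    by (subst eq) (auto simp: F_bounds)
  also have "\<dots> = ennreal (p * (\<integral>\<omega>. F (True ## \<omega>) \<partial>step_space p)
      + (1 - p) * (\<integral>\<omega>. F (False ## \<omega>) \<partial>step_space p))"
    using p nonneg by (simp add: ennreal_mult'' ennreal_plus mult.commute)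
  finally show ?thesis
    using p nonneg F_bounds by (subst (asm) ennreal_inj) auto
qed

lemma hitting_time_walk_SCons:
  assumes "0 < x" "x < a" "c = 0 \<or> c = a"
  shows "hitting_time c (walk a x (b ## \<omega>))
    = eSuc (hitting_time c (walk a (if b then x + 1 else x - 1) \<omega>))"
proof -
  have "hitting_time c (walk a x (b ## \<omega>))
      = eSuc (hitting_time c (\<lambda>n. walk a x (b ## \<omega>) (Suc n)))"
    using assms by (intro hitting_time_shift) auto
  then show ?thesis
    by (simp only: walk_SCons[OF assms(1,2)])
qed

lemma walk_u_0:
  assumes "0 < a"
  shows "walk_u a p 0 \<gamma> = 1"
proof -
  interpret S: prob_space "step_space p"
    by (rule prob_space_step_space)
  \<comment> \<open>Here \<open>0 < a\<close> matters: the walk rests at 0 and never meets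
    \<open>a\<close>, so the indicator is 1.\<close>
  have "hitting_time 0 (walk a 0 \<omega>) = 0" "hitting_time a (walk a 0 \<omega>) = \<infinity>" for \<omega>
    using assms by (auto intro!: hitting_time_start hitting_time_never simp: walk_absorbed)
  then show ?thesis
    by (simp add: walk_u_def S.prob_space)
qed

lemma walk_u_a:
  assumes "0 < a"
  shows "walk_u a p a \<gamma> = 0"
proof -
  have "hitting_time 0 (walk a a \<omega>) = \<infinity>" for \<omega>
    using assms by (auto intro!: hitting_time_never simp: walk_absorbed)
  then show ?thesis
    by (simp add: walk_u_def)
qed

lemma walk_s_boundary:
  assumes "x = 0 \<or> x = a"
  shows "walk_s a p x \<gamma> = 1"
proof -
  interpret S: prob_space "step_space p"
    by (rule prob_space_step_space)
  have "min (hitting_time 0 (walk a x \<omega>)) (hitting_time a (walk a x \<omega>)) = 0" for \<omega>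
    using assms hitting_time_start[of "walk a x \<omega>" x] by (auto simp: min_def)
  then show ?thesis
    by (simp add: walk_s_def S.prob_space)
qed

lemma walk_u_first_step:
  assumes "0 < p" "p < 1" "0 < \<gamma>" "\<gamma> < 1" "0 < x" "x < a"
  shows "walk_u a p x \<gamma>
    = (1 - \<gamma>) * (p * walk_u a p (x + 1) \<gamma> + (1 - p) * walk_u a p (x - 1) \<gamma>)"
proof -
  \<comment> \<open>A prepended letter raises both hitting times by one: their comparison is
    unchanged and the discount gains one factor \<open>1 - \<gamma>\<close>.\<close>
  have shift: "(\<integral>\<omega>. discount (1 - \<gamma>) (hitting_time 0 (walk a x (b ## \<omega>)))
          * of_bool (hitting_time 0 (walk a x (b ## \<omega>)) < hitting_time a (walk a x (b ## \<omega>))) \<partial>step_space p)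
        = (1 - \<gamma>) * walk_u a p (if b then x + 1 else x - 1) \<gamma>" for b
    using assms by (simp add: walk_u_def hitting_time_walk_SCons discount_eSuc mult.assoc)
  have "walk_u a p x \<gamma> = p * ((1 - \<gamma>) * walk_u a p (x + 1) \<gamma>)
      + (1 - p) * ((1 - \<gamma>) * walk_u a p (x - 1) \<gamma>)"
    using assms shift[of True] shift[of False]
    unfolding walk_u_def[of a p x]
    by (subst integral_step_space) (auto simp: discount_nonneg discount_le_1)
  then show ?thesis
    by (simp add: algebra_simps)
qed

lemma walk_s_first_step:
  assumes "0 < p" "p < 1" "0 < \<gamma>" "\<gamma> < 1" "0 < x" "x < a"
  shows "walk_s a p x \<gamma>
    = (1 - \<gamma>) * (p * walk_s a p (x + 1) \<gamma> + (1 - p) * walk_s a p (x - 1) \<gamma>)"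
proof -
  have min_eSuc: "min (eSuc m) (eSuc n) = eSuc (min m n)" for m n
    by (simp add: min_def)
  have shift: "(\<integral>\<omega>. discount (1 - \<gamma>)
          (min (hitting_time 0 (walk a x (b ## \<omega>))) (hitting_time a (walk a x (b ## \<omega>)))) \<partial>step_space p)
        = (1 - \<gamma>) * walk_s a p (if b then x + 1 else x - 1) \<gamma>" for b
    using assms by (simp add: walk_s_def hitting_time_walk_SCons min_eSuc discount_eSuc)
  have "walk_s a p x \<gamma> = p * ((1 - \<gamma>) * walk_s a p (x + 1) \<gamma>)
      + (1 - p) * ((1 - \<gamma>) * walk_s a p (x - 1) \<gamma>)"
    using assms shift[of True] shift[of False]
    unfolding walk_s_def[of a p x]
    by (subst integral_step_space) (auto simp: discount_nonneg discount_le_1)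
  then show ?thesis
    by (simp add: algebra_simps)
qed

text \<open>Induction away from 0, where the value is 1. In the first-step equation the upper
  neighbour contributes a nonnegative term and the lower one a positive term.\<close>

lemma walk_s_pos:
  assumes "0 < p" "p < 1" "0 < \<gamma>" "\<gamma> < 1" "x < a"
  shows "0 < walk_s a p x \<gamma>"
  using assms(5)
proof (induction x)
  case 0
  then show ?case by (simp add: walk_s_boundary)
next
  case (Suc x)
  have "0 \<le> walk_s a p (Suc x + 1) \<gamma>"
    using assms unfolding walk_s_def by (intro Bochner_Integration.integral_nonneg discount_nonneg) simp
  moreover have "0 < walk_s a p x \<gamma>"
    using Suc by simp
  ultimately have "0 < (1 - \<gamma>) * (p * walk_s a p (Suc x + 1) \<gamma> + (1 - p) * walk_s a p x \<gamma>)"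
    using assms by (intro mult_pos_pos add_nonneg_pos) auto
  also have "\<dots> = walk_s a p (Suc x) \<gamma>"
    using assms Suc.prems by (subst walk_s_first_step[of p \<gamma> "Suc x" a]) auto
  finally show ?case .
qed

section \<open>Uniqueness for the discounted Dirichlet problem\<close>

text \<open>Maximum principle: \<open>\<bar>D\<bar>\<close> is at most \<open>r < 1\<close> times its maximum, hence zero.\<close>

lemma first_step_unique:
  fixes D :: "nat \<Rightarrow> real"
  assumes r: "0 \<le> r" "r < 1" and pq: "0 \<le> p" "0 \<le> q" "p + q = 1"
    and boundary: "D 0 = 0" "D a = 0"
    and step: "\<And>x. 0 < x \<Longrightarrow> x < a \<Longrightarrow> D x = r * (p * D (x + 1) + q * D (x - 1))"
    and "x \<le> a"
  shows "D x = 0"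
proof -
  define M where "M = Max ((\<lambda>x. \<bar>D x\<bar>) ` {..a})"
  have le: "\<bar>D x\<bar> \<le> M" if "x \<le> a" for x
    using that by (auto simp: M_def)
  have "M \<in> (\<lambda>x. \<bar>D x\<bar>) ` {..a}"
    unfolding M_def by (intro Max_in) auto
  then obtain y where y: "y \<le> a" "M = \<bar>D y\<bar>"
    by auto
  have M0: "0 \<le> M"
    using y by simp
  have "M \<le> r * M"
  proof (cases "y = 0 \<or> y = a")
    case True
    then show ?thesis using y boundary by auto
  next
    case False
    then have "M = r * \<bar>p * D (y + 1) + q * D (y - 1)\<bar>"
      using y step[of y] r by (simp add: abs_mult)
    also have "\<dots> \<le> r * (p * M + q * M)"
    proof (intro mult_left_mono r)
      have "\<bar>p * D (y + 1) + q * D (y - 1)\<bar> \<le> p * \<bar>D (y + 1)\<bar> + q * \<bar>D (y - 1)\<bar>"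
        using pq by (intro order.trans[OF abs_triangle_ineq]) (simp add: abs_mult)
      also have "\<dots> \<le> p * M + q * M"
        using y False by (intro add_mono mult_left_mono le pq) auto
      finally show "\<bar>p * D (y + 1) + q * D (y - 1)\<bar> \<le> p * M + q * M" .
    qed
    also have "\<dots> = r * M"
      using pq by (simp add: distrib_right[symmetric])
    finally show ?thesis .
  qed
  then have "(1 - r) * M \<le> 0"
    by (simp add: algebra_simps)
  then have "M = 0"
    using r M0 by (simp add: mult_le_0_iff)
  then show ?thesis
    using le[OF \<open>x \<le> a\<close>] by simp
qed

section \<open>Spectral expansion\<close>

lemma sum_cos_multiples:
  fixes k :: nat
  assumes k: "0 < k" "k < 2 * a"
  shows "(\<Sum>\<nu><a. cos (pi * real \<nu> * real k / real a)) = (1 - (-1) ^ k) / 2"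
proof -
  define t where "t = pi * real k / real a"
  have a: "0 < a" using k by simp
  \<comment> \<open>The factor \<open>2 * sin (t / 2)\<close> turns each cosine into a difference of
    sines at half-integer multiples of \<open>t\<close>, so the sum telescopes. The case
    \<open>n = a\<close> is the one of interest, since
    \<open>real a * t = real k * pi\<close>.\<close>
  have "2 * sin (t / 2) * (\<Sum>\<nu><n. cos (real \<nu> * t)) = sin ((real n - 1 / 2) * t) + sin (t / 2)" for n
  proof (induction n)
    case (Suc n)
    have "2 * sin (t / 2) * cos (real n * t) = sin ((real n + 1 / 2) * t) - sin ((real n - 1 / 2) * t)"
      using sin_times_cos[of "t / 2" "real n * t"] sin_minus[of "(real n - 1 / 2) * t"]
      by (simp add: algebra_simps)
    then show ?case
      using Suc by (simp add: algebra_simps)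
  qed simp
  from this[of a] have "2 * sin (t / 2) * (\<Sum>\<nu><a. cos (real \<nu> * t)) = sin (real k * pi - t / 2) + sin (t / 2)"
    using a by (simp add: t_def algebra_simps)
  also have "\<dots> = sin (t / 2) * (1 - (-1) ^ k)"
    by (simp add: sin_diff algebra_simps)
  finally have "sin (t / 2) * (2 * (\<Sum>\<nu><a. cos (real \<nu> * t)) - (1 - (-1) ^ k)) = 0"
    by (simp add: algebra_simps)
  \<comment> \<open>The bounds on \<open>k\<close> place \<open>t / 2\<close> strictly between 0 and
    \<open>pi\<close>, so this factor cancels.\<close>
  moreover have "0 < sin (t / 2)"
    using k a by (intro sin_gt_zero) (auto simp: t_def field_simps)
  ultimately have "(\<Sum>\<nu><a. cos (real \<nu> * t)) = (1 - (-1) ^ k) / 2"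
    by simp
  then show ?thesis
    by (simp add: t_def algebra_simps)
qed

text \<open>Product-to-sum gives cosine sums with frequencies \<open>y - x\<close> and
  \<open>y + x\<close>. These have equal parity, so the two sums agree and cancel for
  \<open>x \<noteq> y\<close>. For \<open>x = y\<close> the first is a sum of ones, equal to
  \<open>a\<close>, and the second is 0.\<close>

lemma sum_sin_sin:
  fixes x y :: nat
  assumes x: "x \<in> {1..a-1}" and y: "y \<in> {1..a-1}"
  shows "(\<Sum>\<nu>=1..a-1. sin (pi * real \<nu> * real x / real a) * sin (pi * real \<nu> * real y / real a))
    = (if x = y then real a / 2 else 0)"
  using x y
proof (induction x y rule: linorder_wlog)
  case (le x y)
  let ?c = "\<lambda>k \<nu>. cos (pi * real \<nu> * real k / real a)"
  have "(\<Sum>\<nu>=1..a-1. sin (pi * real \<nu> * real x / real a) * sin (pi * real \<nu> * real y / real a))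
      = (\<Sum>\<nu><a. sin (pi * real \<nu> * real x / real a) * sin (pi * real \<nu> * real y / real a))"
    by (rule sum.mono_neutral_left) (auto simp: not_le)
  also have "\<dots> = (\<Sum>\<nu><a. (?c (y - x) \<nu> - ?c (y + x) \<nu>) / 2)"
  proof (rule sum.cong)
    fix \<nu>
    show "sin (pi * real \<nu> * real x / real a) * sin (pi * real \<nu> * real y / real a)
        = (?c (y - x) \<nu> - ?c (y + x) \<nu>) / 2"
      using le sin_times_sin[of "pi * real \<nu> * real y / real a" "pi * real \<nu> * real x / real a"]
      by (simp add: of_nat_diff algebra_simps add_divide_distrib diff_divide_distrib)
  qed simp
  also have "\<dots> = ((\<Sum>\<nu><a. ?c (y - x) \<nu>) - (\<Sum>\<nu><a. ?c (y + x) \<nu>)) / 2"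
    by (simp add: sum_subtractf sum_divide_distrib diff_divide_distrib)
  also have "(\<Sum>\<nu><a. ?c (y + x) \<nu>) = (1 - (-1) ^ (y + x)) / 2"
    using le by (intro sum_cos_multiples) auto
  also have "(-1) ^ (y + x) = ((-1) ^ (y - x) :: real)"
    using le by (auto simp: minus_one_power_iff)
  also have "((\<Sum>\<nu><a. ?c (y - x) \<nu>) - (1 - (-1) ^ (y - x)) / 2) / 2 = (if x = y then real a / 2 else 0)"
  proof (cases "x = y")
    case False
    then show ?thesis
      using le by (subst sum_cos_multiples) auto
  qed simp
  finally show ?case .
next
  case (sym x y)
  have "(\<Sum>\<nu>=1..a-1. sin (pi * real \<nu> * real x / real a) * sin (pi * real \<nu> * real y / real a))
      = (\<Sum>\<nu>=1..a-1. sin (pi * real \<nu> * real y / real a) * sin (pi * real \<nu> * real x / real a))"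
    by (intro sum.cong refl mult.commute)
  then show ?case
    using sym by auto
qed

section \<open>Eigenvalues and eigenvectors of the killed walk\<close>

lemma walk_lambda_less_1:
  assumes "0 < p" "0 < q" "p + q = 1" "\<nu> \<in> {1..a-1}"
  shows "walk_lambda a p q \<nu> < 1"
proof -
  \<comment> \<open>AM-GM only yields \<open>2 * sqrt (p * q) \<le> 1\<close>, with equality for
    \<open>p = q\<close>. Strictness comes from the cosine, whose angle lies strictly between 0 and
    \<open>pi\<close>.\<close>
  have "4 * (p * q) \<le> (p + q)\<^sup>2"
    using sum_squares_bound[of p q] by (simp add: power2_sum)
  then have "sqrt (4 * (p * q)) \<le> 1"
    using assms by simp
  then have "2 * sqrt (p * q) \<le> 1"
    by (simp add: real_sqrt_mult)
  moreover have "cos (pi * real \<nu> / real a) < cos 0"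
    using assms by (intro cos_monotone_0_pi) (auto simp: field_simps)
  moreover have "0 < 2 * sqrt (p * q)"
    using assms by simp
  ultimately show ?thesis
    using mult_strict_left_mono[of "cos (pi * real \<nu> / real a)" 1 "2 * sqrt (p * q)"]
    unfolding walk_lambda_def cos_zero by linarith
qed

lemma walk_lambda_inj_on:
  assumes "0 < p" "0 < q"
  shows "inj_on (walk_lambda a p q) {1..a-1}"
proof (rule inj_onI)
  fix \<mu> \<nu> assume *: "\<mu> \<in> {1..a-1}" "\<nu> \<in> {1..a-1}" "walk_lambda a p q \<mu> = walk_lambda a p q \<nu>"
  then have "cos (pi * real \<mu> / real a) = cos (pi * real \<nu> / real a)"
    using assms by (simp add: walk_lambda_def)
  moreover have "0 \<le> pi * real k / real a" "pi * real k / real a \<le> pi" if "k \<in> {1..a-1}" for k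
    using that by (auto simp: field_simps)
  ultimately have "pi * real \<mu> / real a = pi * real \<nu> / real a"
    using *(1,2) cos_inj_pi by blast
  then show "\<mu> = \<nu>"
    using *(1,2) by auto
qed

lemma walk_f_resolvent:
  assumes "0 < p" "0 < q" "p + q = 1" "\<nu> \<in> {1..a-1}" "0 < \<gamma>" "\<gamma> < 1"
  shows "walk_f a p q \<nu> \<gamma> * (1 - walk_lambda a p q \<nu> * (1 - \<gamma>)) = 1 - \<gamma>"
proof -
  \<comment> \<open>Because \<open>1 - \<gamma>\<close> is positive, this bound covers eigenvalues
    of either sign and keeps the denominator above \<open>\<gamma>\<close>.\<close>
  have "walk_lambda a p q \<nu> * (1 - \<gamma>) < 1 * (1 - \<gamma>)"
    using assms walk_lambda_less_1[OF assms(1-4)] by (intro mult_strict_right_mono) auto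
  then have "1 - walk_lambda a p q \<nu> * (1 - \<gamma>) \<noteq> 0"
    using \<open>0 < \<gamma>\<close> by auto
  then show ?thesis
    by (simp add: walk_f_def)
qed

text \<open>The weight \<open>(q / p) powr (x / 2)\<close> symmetrises the walk: up and down moves
  both acquire the coefficient \<open>sqrt (p * q)\<close>. The sine addition formulas then produce
  the factor \<open>2 * cos t\<close>. Positivity of \<open>x\<close> makes \<open>x - 1\<close> the
  true predecessor.\<close>

lemma walk_A_eigenvector:
  assumes "0 < p" "0 < q" "0 < x"
  shows "p * walk_A a p q \<nu> (x + 1) + q * walk_A a p q \<nu> (x - 1)
    = walk_lambda a p q \<nu> * walk_A a p q \<nu> x"
proof -
  define t where "t = pi * real \<nu> / real a"
  define c where "c = 2 * sqrt (p * q) / real a * sin t"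
  define g where "g = (q / p) powr (real x / 2)"
  have A: "walk_A a p q \<nu> y = c * (q / p) powr (real y / 2) * sin (t * real y)" for y
    by (simp add: walk_A_def c_def t_def)
  have half: "(q / p) powr (1 / 2) = sqrt q / sqrt p"
    using assms by (simp add: powr_half_sqrt real_sqrt_divide)
  have "(q / p) powr (real (x + 1) / 2) = g * (sqrt q / sqrt p)"
    unfolding g_def half[symmetric] powr_add[symmetric] by (simp add: add_divide_distrib add.commute)
  moreover have "(q / p) powr (real (x - 1) / 2) = g / (sqrt q / sqrt p)"
    unfolding g_def half[symmetric] powr_diff[symmetric]
    using assms by (simp add: of_nat_diff diff_divide_distrib)
  moreover have "p * (sqrt q / sqrt p) = sqrt (p * q)" "q / (sqrt q / sqrt p) = sqrt (p * q)"
    using assms by (simp_all add: real_sqrt_mult real_div_sqrt field_simps)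
  ultimately have pq: "p * (q / p) powr (real (x + 1) / 2) = sqrt (p * q) * g"
    "q * (q / p) powr (real (x - 1) / 2) = sqrt (p * q) * g"
    by (metis mult.left_commute mult.commute, metis times_divide_eq_right mult.commute)
  have "p * walk_A a p q \<nu> (x + 1) + q * walk_A a p q \<nu> (x - 1)
      = c * (p * (q / p) powr (real (x + 1) / 2)) * sin (t * real (x + 1))
        + c * (q * (q / p) powr (real (x - 1) / 2)) * sin (t * real (x - 1))"
    unfolding A by (simp only: ac_simps)
  also have "\<dots> = c * sqrt (p * q) * g * (sin (t * real x + t) + sin (t * real x - t))"
    unfolding pq using assms by (simp add: of_nat_diff algebra_simps)
  also have "\<dots> = walk_lambda a p q \<nu> * walk_A a p q \<nu> x"
    unfolding A by (simp add: sin_add sin_diff walk_lambda_def t_def g_def)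
  finally show ?thesis .
qed

text \<open>The factor \<open>sin (pi * \<nu> / a)\<close> in \<open>walk_A\<close> is the sine mode
  at site 1, so the sum is an orthogonality relation between \<open>x\<close> and 1. At
  \<open>x = 1\<close> the prefactor is \<open>sqrt (p * q) * sqrt (q / p) = q\<close>.\<close>

lemma sum_walk_A:
  assumes "0 < p" "0 < q" "2 \<le> a" "x \<in> {1..a-1}"
  shows "(\<Sum>\<nu>=1..a-1. walk_A a p q \<nu> x) = q * of_bool (x = 1)"
proof -
  have "(\<Sum>\<nu>=1..a-1. walk_A a p q \<nu> x) = 2 * sqrt (p * q) / real a * (q / p) powr (real x / 2)
      * (\<Sum>\<nu>=1..a-1. sin (pi * real \<nu> * real x / real a) * sin (pi * real \<nu> * real 1 / real a))"
    by (simp add: walk_A_def sum_distrib_left mult.assoc)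
  also have "\<dots> = sqrt (p * q) * (q / p) powr (real x / 2) * of_bool (x = 1)"
    using assms by (subst sum_sin_sin) auto
  also have "\<dots> = q * of_bool (x = 1)"
    using assms by (auto simp: powr_half_sqrt real_sqrt_mult real_sqrt_divide)
  finally show ?thesis .
qed

lemma walk_B_eq_walk_A: "x \<le> a \<Longrightarrow> walk_B a p q \<nu> x = walk_A a q p \<nu> (a - x)"
  unfolding walk_A_def walk_B_def by (simp only: of_nat_diff mult.commute[of p q])

lemma walk_f_commute: "walk_f a p q = walk_f a q p"
  by (simp add: fun_eq_iff walk_f_def walk_lambda_def mult.commute[of p q])

section \<open>The expansions as solutions of the Dirichlet problem\<close>

text \<open>All \<open>A\<^sub>\<nu>\<close> vanish at \<open>0\<close>; the extra summand restores the boundary value \<open>1\<close> there.\<close>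

definition walk_expansion :: "nat \<Rightarrow> real \<Rightarrow> real \<Rightarrow> nat \<Rightarrow> real \<Rightarrow> real" where
  "walk_expansion a p q x \<gamma> = (\<Sum>\<nu>=1..a-1. walk_f a p q \<nu> \<gamma> * walk_A a p q \<nu> x) + of_bool (x = 0)"

lemma walk_A_boundary:
  assumes "0 < a" "x = 0 \<or> x = a"
  shows "walk_A a p q \<nu> x = 0"
  using assms sin_npi[of \<nu>] by (auto simp: walk_A_def mult.commute[of pi])

lemma walk_expansion_boundary:
  assumes "0 < a"
  shows "walk_expansion a p q 0 \<gamma> = 1" "walk_expansion a p q a \<gamma> = 0"
  using assms by (simp_all add: walk_expansion_def walk_A_boundary)

text \<open>The bare sum \<open>E\<close> misses the homogeneous equation by
  \<open>1 - \<gamma>\<close> times the sum of the \<open>walk_A\<close>, which is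
  \<open>(1 - \<gamma>) * q\<close> at site 1 and 0 at the other interior sites. This is exactly
  what the boundary value 1 at site 0 contributes to its neighbour.\<close>

lemma walk_expansion_first_step:
  assumes pq: "0 < p" "0 < q" "p + q = 1" and a: "2 \<le> a" and \<gamma>: "0 < \<gamma>" "\<gamma> < 1"
    and x: "0 < x" "x < a"
  shows "walk_expansion a p q x \<gamma>
    = (1 - \<gamma>) * (p * walk_expansion a p q (x + 1) \<gamma> + q * walk_expansion a p q (x - 1) \<gamma>)"
proof -
  let ?f = "\<lambda>\<nu>. walk_f a p q \<nu> \<gamma>" and ?A = "walk_A a p q"
  define E where "E x = (\<Sum>\<nu>=1..a-1. ?f \<nu> * ?A \<nu> x)" for x
  have "E x - (1 - \<gamma>) * (p * E (x + 1) + q * E (x - 1))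
    = (\<Sum>\<nu>=1..a-1. ?f \<nu> * (?A \<nu> x - (1 - \<gamma>) * (p * ?A \<nu> (x + 1) + q * ?A \<nu> (x - 1))))"
    unfolding E_def sum_distrib_left sum.distrib[symmetric] sum_subtractf[symmetric]
    by (intro sum.cong refl) (simp add: algebra_simps)
  also have "\<dots> = (\<Sum>\<nu>=1..a-1. (1 - \<gamma>) * ?A \<nu> x)"
  proof (rule sum.cong)
    fix \<nu> assume "\<nu> \<in> {1..a-1}"
    then have "?f \<nu> * (1 - walk_lambda a p q \<nu> * (1 - \<gamma>)) = 1 - \<gamma>"
      using walk_f_resolvent pq \<gamma> by blast
    moreover have "?f \<nu> * (?A \<nu> x - (1 - \<gamma>) * (p * ?A \<nu> (x + 1) + q * ?A \<nu> (x - 1)))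
        = ?f \<nu> * (1 - walk_lambda a p q \<nu> * (1 - \<gamma>)) * ?A \<nu> x"
      unfolding walk_A_eigenvector[OF pq(1,2) x(1)] by (simp add: algebra_simps)
    ultimately show "?f \<nu> * (?A \<nu> x - (1 - \<gamma>) * (p * ?A \<nu> (x + 1) + q * ?A \<nu> (x - 1)))
        = (1 - \<gamma>) * ?A \<nu> x"
      by simp
  qed simp
  also have "\<dots> = (1 - \<gamma>) * (q * of_bool (x = 1))"
    using sum_walk_A[of p q a x] pq a x by (simp add: sum_distrib_left[symmetric])
  finally have "E x = (1 - \<gamma>) * (p * E (x + 1) + q * (E (x - 1) + of_bool (x = 1)))"
    by (simp add: algebra_simps)
  moreover have "walk_expansion a p q y \<gamma> = E y + of_bool (y = 0)" for y
    by (simp add: walk_expansion_def E_def)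
  moreover have "x \<noteq> 0" "x + 1 \<noteq> 0" "x - 1 = 0 \<longleftrightarrow> x = 1"
    using x by auto
  ultimately show ?thesis
    by simp
qed

lemma walk_u_expansion:
  assumes pq: "0 < p" "0 < q" "p + q = 1" and a: "2 \<le> a" and \<gamma>: "0 < \<gamma>" "\<gamma> < 1"
    and x: "x \<in> {1..a-1}"
  shows "walk_u a p x \<gamma> = (\<Sum>\<nu>=1..a-1. walk_f a p q \<nu> \<gamma> * walk_A a p q \<nu> x)"
proof -
  define D where "D x = walk_u a p x \<gamma> - walk_expansion a p q x \<gamma>" for x
  have p_compl: "1 - p = q"
    using pq by auto
  have "D x = 0"
  proof (rule first_step_unique[of "1 - \<gamma>" p q D a])
    fix y assume y: "0 < y" "y < a"
    have u: "walk_u a p y \<gamma>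
        = (1 - \<gamma>) * (p * walk_u a p (y + 1) \<gamma> + q * walk_u a p (y - 1) \<gamma>)"
      using walk_u_first_step[of p \<gamma> y a] y pq \<gamma> by (simp add: p_compl)
    show "D y = (1 - \<gamma>) * (p * D (y + 1) + q * D (y - 1))"
      unfolding D_def u walk_expansion_first_step[OF pq a \<gamma> y] by (simp add: algebra_simps)
  qed (use assms in \<open>auto simp: D_def walk_u_0 walk_u_a walk_expansion_boundary\<close>)
  then show ?thesis
    using x by (simp add: D_def walk_expansion_def)
qed

lemma walk_s_expansion:
  assumes pq: "0 < p" "0 < q" "p + q = 1" and a: "2 \<le> a" and \<gamma>: "0 < \<gamma>" "\<gamma> < 1"
    and x: "x \<in> {1..a-1}"
  shows "walk_s a p x \<gamma> = (\<Sum>\<nu>=1..a-1. walk_f a p q \<nu> \<gamma> * (walk_A a p q \<nu> x + walk_B a p q \<nu> x))"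
proof -
  \<comment> \<open>Exit at \<open>a\<close> from \<open>x\<close> is exit at 0 from
    \<open>a - x\<close> for the walk with \<open>p\<close> and \<open>q\<close> exchanged. At each
    endpoint exactly one of the two expansions is 1, matching the value 1 of
    \<open>walk_s\<close>.\<close>
  define D where "D x = walk_s a p x \<gamma> - walk_expansion a p q x \<gamma> - walk_expansion a q p (a - x) \<gamma>" for x
  have p_compl: "1 - p = q"
    using pq by auto
  have "D x = 0"
  proof (rule first_step_unique[of "1 - \<gamma>" p q D a])
    fix y assume y: "0 < y" "y < a"
    have s: "walk_s a p y \<gamma>
        = (1 - \<gamma>) * (p * walk_s a p (y + 1) \<gamma> + q * walk_s a p (y - 1) \<gamma>)"
      using walk_s_first_step[of p \<gamma> y a] y pq \<gamma> by (simp add: p_compl)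
    have reflect: "a - y + 1 = a - (y - 1)" "a - y - 1 = a - (y + 1)"
      using y by auto
    have B: "walk_expansion a q p (a - y) \<gamma>
      = (1 - \<gamma>) * (q * walk_expansion a q p (a - (y - 1)) \<gamma>
        + p * walk_expansion a q p (a - (y + 1)) \<gamma>)"
      unfolding reflect[symmetric] using pq a \<gamma> y by (intro walk_expansion_first_step) auto
    show "D y = (1 - \<gamma>) * (p * D (y + 1) + q * D (y - 1))"
      unfolding D_def s walk_expansion_first_step[OF pq a \<gamma> y] B by (simp add: algebra_simps)
  qed (use assms in \<open>auto simp: D_def walk_s_boundary walk_expansion_boundary\<close>)
  moreover have "walk_B a p q \<nu> x = walk_A a q p \<nu> (a - x)" for \<nu>
    using x by (intro walk_B_eq_walk_A) auto
  moreover have "x \<noteq> 0" "a - x \<noteq> 0"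
    using x by auto
  ultimately show ?thesis
    by (simp add: D_def walk_expansion_def walk_f_commute[of a q p] distrib_left sum.distrib)
qed

section \<open>Linear independence\<close>

text \<open>Multiplying out the denominators gives a polynomial with infinitely many zeros; evaluation
  at a pole isolates one coefficient.\<close>

lemma simple_poles_independent:
  fixes l c :: "'a \<Rightarrow> real"
  assumes fin: "finite I" and inj: "inj_on l I"
    and less: "\<And>i. i \<in> I \<Longrightarrow> l i \<le> b"
    and zero: "\<And>x. x > b \<Longrightarrow> (\<Sum>i\<in>I. c i / (x - l i)) = 0"
    and j: "j \<in> I"
  shows "c j = 0"
proof -
  define P where "P = (\<Sum>i\<in>I. smult (c i) (\<Prod>k\<in>I - {i}. [:- l k, 1:]))"
  have P: "poly P x = (\<Sum>i\<in>I. c i * (\<Prod>k\<in>I - {i}. x - l k))" for x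
    by (simp add: P_def poly_sum poly_prod)
  have "poly P x = 0" if "x > b" for x
  proof -
    have "poly P x = (\<Prod>k\<in>I. x - l k) * (\<Sum>i\<in>I. c i / (x - l i))"
      unfolding P sum_distrib_left
    proof (rule sum.cong)
      fix i assume i: "i \<in> I"
      then have "x - l i \<noteq> 0"
        using less[OF i] that by simp
      then show "c i * (\<Prod>k\<in>I - {i}. x - l k) = (\<Prod>k\<in>I. x - l k) * (c i / (x - l i))"
        using prod.remove[OF fin i, of "\<lambda>k. x - l k"] by simp
    qed simp
    then show ?thesis
      using zero[OF that] by simp
  qed
  then have "{b<..} \<subseteq> {x. poly P x = 0}"
    by auto
  then have "infinite {x. poly P x = 0}"
    using infinite_Ioi[of b] finite_subset by blast
  then have "P = 0"
    using poly_roots_finite by blast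
  then have "0 = (\<Sum>i\<in>I. c i * (\<Prod>k\<in>I - {i}. l j - l k))"
    using P[of "l j"] by simp
  also have "\<dots> = c j * (\<Prod>k\<in>I - {j}. l j - l k)"
  proof -
    \<comment> \<open>For \<open>i \<noteq> j\<close> the index \<open>j\<close> stays in the
      product and gives the factor \<open>l j - l j\<close>. The surviving product is nonzero by
      injectivity of \<open>l\<close>.\<close>
    have "(\<Prod>k\<in>I - {i}. l j - l k) = 0" if "i \<noteq> j" for i
      using that fin j by (intro prod_zero) auto
    then show ?thesis
      by (subst sum.remove[OF fin j]) simp
  qed
  finally show ?thesis
    using fin inj j by (auto simp: inj_on_def)
qed

lemma walk_f_independent:
  assumes pq: "0 < p" "0 < q" "p + q = 1"
    and zero: "\<forall>\<gamma>\<in>{0<..<1}. (\<Sum>\<nu>=1..a-1. c \<nu> * walk_f a p q \<nu> \<gamma>) = 0"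
    and \<nu>: "\<nu> \<in> {1..a-1}"
  shows "c \<nu> = 0"
proof (rule simple_poles_independent[where l = "walk_lambda a p q" and I = "{1..a-1}" and b = 1])
  fix x :: real assume x: "1 < x"
  \<comment> \<open>The substitution \<open>1 - \<gamma> = 1 / x\<close> identifies the interval
    (0,1) with \<open>x > 1\<close>.\<close>
  have pole: "c \<mu> * walk_f a p q \<mu> (1 - 1 / x) = c \<mu> / (x - walk_lambda a p q \<mu>)" for \<mu>
    using x by (simp add: walk_f_def field_simps)
  have "1 - 1 / x \<in> {0<..<1}"
    using x by simp
  from bspec[OF zero this] show "(\<Sum>\<mu>=1..a-1. c \<mu> / (x - walk_lambda a p q \<mu>)) = 0"
    unfolding pole .
next
  show "walk_lambda a p q \<mu> \<le> 1" if "\<mu> \<in> {1..a-1}" for \<mu>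
    using walk_lambda_less_1[OF pq that] by simp
qed (use walk_lambda_inj_on[OF pq(1,2)] \<nu> in simp_all)

text \<open>After cancelling the factors independent of the site, the sine vectors satisfy a
  relation with coefficients \<open>c i * g (z i)\<close>. Pairing it with the mode at
  \<open>z j\<close> and swapping sums leaves only \<open>i = j\<close>, since \<open>z\<close> is
  injective.\<close>

lemma walk_A_independent:
  fixes z :: "'m::finite \<Rightarrow> nat"
  assumes pq: "0 < p" "0 < q" and inj: "inj z" and z: "\<And>i. z i \<in> {1..a-1}"
    and zero: "\<forall>\<nu>\<in>{1..a-1}. (\<Sum>i\<in>UNIV. c i * walk_A a p q \<nu> (z i)) = 0"
  shows "c j = 0"
proof -
  define g where "g x = (q / p) powr (real x / 2)" for x :: nat
  define S where "S \<nu> x = sin (pi * real \<nu> * real x / real a)" for \<nu> x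
  have a: "0 < a"
    using z[of j] by auto
  have S0: "(\<Sum>i\<in>UNIV. c i * g (z i) * S \<nu> (z i)) = 0" if \<nu>: "\<nu> \<in> {1..a-1}" for \<nu>
  proof -
    have "0 < sin (pi * real \<nu> / real a)"
      using \<nu> by (intro sin_gt_zero) (auto simp: field_simps)
    moreover have "(\<Sum>i\<in>UNIV. c i * walk_A a p q \<nu> (z i))
        = 2 * sqrt (p * q) / real a * sin (pi * real \<nu> / real a)
          * (\<Sum>i\<in>UNIV. c i * g (z i) * S \<nu> (z i))"
      by (simp add: walk_A_def g_def S_def sum_distrib_left mult_ac)
    ultimately show ?thesis
      using zero \<nu> pq a by auto
  qed
  have orth: "(\<Sum>\<nu>=1..a-1. S \<nu> (z i) * S \<nu> (z j)) = (if i = j then real a / 2 else 0)" for i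
    unfolding S_def sum_sin_sin[OF z z] inj_eq[OF inj] ..
  have "0 = (\<Sum>\<nu>=1..a-1. (\<Sum>i\<in>UNIV. c i * g (z i) * S \<nu> (z i)) * S \<nu> (z j))"
    using S0 by simp
  also have "\<dots> = (\<Sum>i\<in>UNIV. c i * g (z i) * (\<Sum>\<nu>=1..a-1. S \<nu> (z i) * S \<nu> (z j)))"
    unfolding sum_distrib_right sum_distrib_left mult.assoc by (rule sum.swap)
  also have "\<dots> = (\<Sum>i\<in>UNIV. if i = j then c i * g (z i) * (real a / 2) else 0)"
    by (intro sum.cong) (simp_all add: orth[simplified])
  also have "\<dots> = c j * g (z j) * (real a / 2)"
    by simp
  finally show ?thesis
    using pq a by (simp add: g_def)
qed

section \<open>Regularity of the coupling functional\<close>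

lemma C1_on_inner_quotient:
  fixes U V :: "'a::real_inner"
  assumes "\<And>w. w \<in> S \<Longrightarrow> w \<bullet> V \<noteq> 0"
  shows "C1_on S (\<lambda>w. (w \<bullet> U) / (w \<bullet> V))"
  unfolding C1_on_def
proof (intro exI conjI ballI)
  \<comment> \<open>The quotient rule in the ambient space; its derivative restricts to any
    \<open>S\<close> on which the denominator does not vanish.\<close>
  let ?D = "\<lambda>w. (1 / (w \<bullet> V)) *\<^sub>R blinfun_inner_left U
    - ((w \<bullet> U) / (w \<bullet> V)\<^sup>2) *\<^sub>R blinfun_inner_left V"
  show "continuous_on S ?D"
    using assms by (intro continuous_intros) auto
  show "((\<lambda>w. (w \<bullet> U) / (w \<bullet> V)) has_derivative blinfun_apply (?D w)) (at w within S)"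
    if "w \<in> S" for w
    using assms[OF that]
    by (auto intro!: derivative_eq_intros
        simp: fun_eq_iff blinfun.diff_left blinfun.scaleR_left field_simps power2_eq_square)
qed

lemma coupling_eq_inner:
  "coupling u s z w \<gamma> = (w \<bullet> (\<chi> i. u (z i) \<gamma>)) / (w \<bullet> (\<chi> i. s (z i) \<gamma>))"
  by (simp add: coupling_def inner_vec_def)

text \<open>Weights summing to 1 cannot all vanish, so at least one term is positive. Boundary
  points of the simplex are included.\<close>

lemma simplex_mean_pos:
  assumes w: "w \<in> prob_simplex" and d: "\<And>i. 0 < d i"
  shows "0 < (\<Sum>i\<in>UNIV. w $ i * d i)"
proof -
  have nonneg: "0 \<le> w $ i" and "(\<Sum>i\<in>UNIV. w $ i) = 1" for i
    using w by (auto simp: prob_simplex_def)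
  then obtain j where "w $ j \<noteq> 0"
    by (metis sum.neutral zero_neq_one)
  then have "0 < w $ j"
    using nonneg[of j] by simp
  then show ?thesis
    using nonneg d by (intro sum_pos2[of _ j]) (auto simp: less_imp_le)
qed

text \<open>Positive values of \<open>s\<close> at the sites keep the denominator nonzero on the
  whole closed simplex, so the same quotient formula gives continuity up to the boundary.\<close>

lemma cond_S1_coupling:
  assumes "\<And>i \<gamma>. 0 < \<gamma> \<Longrightarrow> \<gamma> < 1 \<Longrightarrow> 0 < s (z i) \<gamma>"
  shows "cond_S1 (coupling u s z)"
  unfolding cond_S1_def
proof (intro ballI)
  fix \<gamma> :: real assume \<gamma>: "\<gamma> \<in> {0<..<1}"
  have ne: "w \<bullet> (\<chi> i. s (z i) \<gamma>) \<noteq> 0" if "w \<in> prob_simplex" for w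
    using simplex_mean_pos[OF that, of "\<lambda>i. s (z i) \<gamma>"] assms \<gamma> by (simp add: inner_vec_def)
  have "C1_on prob_simplex_interior (\<lambda>w. coupling u s z w \<gamma>)"
    unfolding coupling_eq_inner
    by (intro C1_on_inner_quotient ne) (simp add: prob_simplex_interior_def)
  moreover have "continuous_on prob_simplex (\<lambda>w. coupling u s z w \<gamma>)"
    unfolding coupling_eq_inner using ne by (intro continuous_intros) auto
  ultimately show "C1_on prob_simplex_interior (\<lambda>w. coupling u s z w \<gamma>)
      \<and> continuous_on prob_simplex (\<lambda>w. coupling u s z w \<gamma>)" ..
qed

section \<open>The four conditions\<close>

text \<open>With \<open>d = a - x\<close>, the sine factors of both sides agree, and the weights
  differ by \<open>(p / q) powr (d / 2)\<close> against \<open>(q / p) powr (d / 2)\<close>. Their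
  ratio \<open>(p / q) ^ (a - x)\<close> is free of \<open>\<nu>\<close> and serves as
  \<open>\<kappa>\<close>.\<close>

lemma walk_B_eq_reflected_walk_A:
  assumes "0 < p" "0 < q" "x \<le> a"
  shows "walk_B a p q \<nu> x = (p / q) ^ (a - x) * walk_A a p q \<nu> (a - x)"
proof -
  define d where "d = real (a - x)"
  have "(q / p) powr (d / 2) = (p / q) powr (- (d / 2))"
    using assms inverse_powr[of "p / q" "d / 2"] by (simp add: powr_minus)
  moreover have "(p / q) ^ (a - x) = (p / q) powr d"
    using assms by (simp add: d_def powr_realpow del: of_nat_diff)
  ultimately have "(p / q) ^ (a - x) * (q / p) powr (d / 2) = (p / q) powr d * (p / q) powr (- (d / 2))"
    by simp
  also have "\<dots> = (p / q) powr (d / 2)"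
    by (simp add: powr_add[symmetric])
  finally have "(p / q) powr (d / 2) = (p / q) ^ (a - x) * (q / p) powr (d / 2)" ..
  then show ?thesis
    using assms(3) unfolding walk_B_eq_walk_A[OF assms(3)] walk_A_def d_def[symmetric]
    by (simp add: mult_ac)
qed

theorem mainTheorem6:
  fixes a :: nat and p q :: real and z :: "'m::finite \<Rightarrow> nat"
  assumes "a \<ge> 3" and "0 < p" and "p < 1" and "q = 1 - p"
    and "inj z"
    and "\<forall>i. z i \<in> {1..a-1}"
    and "\<forall>x\<in>range z. a - x \<in> range z"
    and "\<exists>x\<in>range z. x \<noteq> a - x"
  shows "cond_S1 (coupling (walk_u a p) (walk_s a p) z)
    \<and> cond_S2 a (walk_u a p) (walk_s a p) z (coupling (walk_u a p) (walk_s a p) z)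
        (a - 1) (walk_f a p q) (walk_A a p q) (walk_B a p q)
    \<and> cond_S3 (range z) (a - 1) (walk_A a p q) (walk_B a p q)
        (\<lambda>x. a - x) (\<lambda>x. (p / q) ^ (a - x))
    \<and> cond_S4 (range z) (\<lambda>x. a - x) (\<lambda>x. (p / q) ^ (a - x)) ((p / q) ^ a)"
proof (intro conjI)
  have q: "0 < q" "p + q = 1"
    using assms by auto
  have z: "z i \<in> {1..a-1}" for i
    using assms by blast
  have z_less: "z i < a" for i
    using z[of i] by auto
  have z_le: "x \<le> a" if "x \<in> range z" for x
    using that z_less by (auto intro: less_imp_le)
  have s_pos: "0 < walk_s a p (z i) \<gamma>" if "0 < \<gamma>" "\<gamma> < 1" for i \<gamma>
    using that assms(2,3) z_less by (intro walk_s_pos)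
  show "cond_S1 (coupling (walk_u a p) (walk_s a p) z)"
    by (intro cond_S1_coupling s_pos)
  show "cond_S2 a (walk_u a p) (walk_s a p) z (coupling (walk_u a p) (walk_s a p) z)
      (a - 1) (walk_f a p q) (walk_A a p q) (walk_B a p q)"
    unfolding cond_S2_def
  proof (intro conjI ballI allI impI)
    fix w :: "real ^ 'm" and \<gamma> :: real assume "w \<in> prob_simplex" "\<gamma> \<in> {0<..<1}"
    then show "0 < (\<Sum>i\<in>UNIV. w $ i * walk_s a p (z i) \<gamma>)"
      by (intro simplex_mean_pos s_pos) auto
  next
    fix x \<gamma> assume "x \<in> {1..a-1}" "\<gamma> \<in> {0<..<1::real}"
    then show "walk_u a p x \<gamma> = (\<Sum>\<nu>=1..a-1. walk_f a p q \<nu> \<gamma> * walk_A a p q \<nu> x)"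
      and "walk_s a p x \<gamma>
        = (\<Sum>\<nu>=1..a-1. walk_f a p q \<nu> \<gamma> * (walk_A a p q \<nu> x + walk_B a p q \<nu> x))"
      using assms q by (intro walk_u_expansion walk_s_expansion; simp)+
  next
    fix c :: "nat \<Rightarrow> real" and \<nu>
    assume "\<forall>\<gamma>\<in>{0<..<1}. (\<Sum>\<nu>=1..a-1. c \<nu> * walk_f a p q \<nu> \<gamma>) = 0" "\<nu> \<in> {1..a-1}"
    then show "c \<nu> = 0"
      using walk_f_independent assms(2) q by blast
  next
    fix c :: "'m \<Rightarrow> real" and i
    assume "\<forall>\<nu>\<in>{1..a-1}. (\<Sum>i\<in>UNIV. c i * walk_A a p q \<nu> (z i)) = 0"
    then show "c i = 0"
      by (rule walk_A_independent[OF assms(2) q(1) assms(5) z])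
  qed (simp add: coupling_def)
  show "cond_S3 (range z) (a - 1) (walk_A a p q) (walk_B a p q)
      (\<lambda>x. a - x) (\<lambda>x. (p / q) ^ (a - x))"
    unfolding cond_S3_def
  proof (intro conjI ballI)
    show "walk_B a p q \<nu> x = (p / q) ^ (a - x) * walk_A a p q \<nu> (a - x)" if "x \<in> range z" for \<nu> x
      using assms(2) q z_le that by (intro walk_B_eq_reflected_walk_A)
    show "\<exists>x\<in>range z. a - x \<noteq> x"
      using assms(8) by metis
  \<comment> \<open>The involution law \<open>a - (a - x) = x\<close> relies on
    \<open>x \<le> a\<close>, as subtraction of naturals is truncated.\<close>
  qed (use assms(2,7) q z_le in auto)
  \<comment> \<open>The exponents \<open>a - x\<close> and \<open>a - (a - x) = x\<close> add up to
    \<open>a\<close>.\<close>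
  show "cond_S4 (range z) (\<lambda>x. a - x) (\<lambda>x. (p / q) ^ (a - x)) ((p / q) ^ a)"
    unfolding cond_S4_def using assms(2) q z_le by (auto simp: power_add[symmetric])
qed

end
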